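(* Suppose the standing assumptions on (P) and on the core function $K$ listed in the context hold. Let $\{w^k\}=\{(u^k,p^k)\}$ be generated by VAPP with $0<\underline{\epsilon}\le\epsilon^{k+1}\le\epsilon^k\le\overline{\epsilon}<\beta/(B_G+B_\Omega+\gamma\tau^2)$ for all $k$, and suppose it converges to $w^*\in\mathbf S^*$. If one of the following conditions holds: (i) $H$ is metric subregular around $(w^*,0)$; (ii) $H_\gamma$ is metric subregular around $(w^*,0)$; then $\{w^k\}$ satisfies the VAPP-iteration-based error bound condition: there exist $c_1>0$ and $\eta>0$ such that $$\mathrm{dist}(w^{k+1},\mathbf S^* )\le c_1\|w^k-w^{k+1}\|\quad\text{whenever }\|w^{k+1}-w^*\|\le\eta.$$
   Context: Norms are Euclidean; $\mathrm{dist}$ is the Euclidean distance to a set ($+\infty$ for the empty set). $\mathbf U\subset\mathbb R^n$ is a nonempty closed convex set; $\mathbf C\subset\mathbb R^m$ is a nonempty closed convex cone with vertex at the origin; $\mathbf C^*=\{y:\langle y,x\rangle\ge0\ \forall x\in\mathbf C\}$; $\Pi$ is the Euclidean projection onto $\mathbf C^*$. Problem (P): minimize $G(u)+J(u)$ subject to $\Theta(u)=\Omega(u)+\Phi(u)\in-\mathbf C$, $u\in\mathbf U$, where $\Omega,\Phi$ map into $\mathbb R^m$. Lagrangian: $L(u,p)=(G+J)(u)+\langle p,\Theta(u)\rangle$. A saddle point of $L$ over $\mathbf U\times\mathbf C^*$ is $(u^*,p^* )\in\mathbf U\times\mathbf C^*$ with $L(u^*,p)\le L(u^*,p^* )\le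 L(u,p^* )$ for all $u\in\mathbf U,p\in\mathbf C^*$. $\mathbf S^*$ is the set of saddle points. Standing assumptions on (P): (H1) $J$ is a convex l.s.c. function (not necessarily differentiable) with $\operatorname{dom}J\cap\mathbf U\ne\emptyset$. (H2) $G$ is convex and differentiable, with derivative Lipschitz with constant $B_G$. (H3) $\Omega$ and $\Phi$ are $\mathbf C$-convex on $\mathbf U$, where $F$ is $\mathbf C$-convex if $F(\alpha u+(1-\alpha)v)-\alpha F(u)-(1-\alpha)F(v)\in-\mathbf C$ for all $u,v\in\mathbf U$, $\alpha\in[0,1]$. (H4) $\Omega$ is differentiable and for every $p\in\mathbb R^m$ the function $f_p(u)=\langle p,\Omega(u)\rangle$ satisfies $\|\nabla f_p(u)-\nabla f_p(v)\|\le B_\Omega\|u-v\|$ for all $u,v\in\mathbf U$, with $B_\Omega$ independent of $p$. (H5) $\Theta$ is Lipschitz with constant $\tau$ on an open set containing $\mathbf U$. (H6) If the interior $\mathring{\mathbf C}\neq\emptyset$, then $\Theta(\mathbf U)\cap(-\mathring{\mathbf C})\ne\emptyset$; if $\mathbf C=\{0\}$, then $0$ is in the interior of $\Theta(\mathbf U)$. (H7) $L$ has at least one saddle point over $\mathbf U\times\mathbf C^*$. Assumption on the core function: $K$ is strongly convex with parameter $\beta>0$ and differentiable with gradient Lipschitz with constant $B$ on $\mathbf U$. Put $D(u,v)=K(u)-K(v)-\langle\nabla K(v),u-v\rangle$. VAPP: fix $\gamma>0$, positive parameters $\epsilon^k$, $u^0\in\mathbf U$, $p^0\in\mathbf C^*$.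 For $k=0,1,\dots$, with $q^k=\Pi(p^k+\gamma\Theta(u^k))$, set $$u^{k+1}=\arg\min_{u\in\mathbf U}\langle\nabla G(u^k),u\rangle+J(u)+\langle q^k,\nabla\Omega(u^k)u+\Phi(u)\rangle+\tfrac1{\epsilon^k}D(u,u^k),\qquad p^{k+1}=\Pi(p^k+\gamma\Theta(u^{k+1})).$$ KKT mappings: $\mathcal N_X(x)=\{\xi:\langle\xi,\zeta-x\rangle\le0\ \forall\zeta\in X\}$ is the normal cone of a convex set $X$ at $x\in X$ (empty for $x\notin X$). For $w=(u,p)\in\mathbb R^n\times\mathbb R^m$, $$H(w)=\begin{pmatrix}\nabla G(u)+\partial J(u)+(\nabla\Omega(u)+\partial\Phi(u))^\top p+\mathcal N_{\mathbf U}(u)\\-\Theta(u)+\mathcal N_{\mathbf C^*}(p)\end{pmatrix},$$ $$H_\gamma(w)=\begin{pmatrix}\nabla G(u)+\partial J(u)+(\nabla\Omega(u)+\partial\Phi(u))^\top\Pi(p+\gamma\Theta(u))+\mathcal N_{\mathbf U}(u)\\-\Theta(u)+\mathcal N_{\mathbf C^*}(p)\end{pmatrix}.$$ Here $\partial$ is the convex subdifferential and, for $p\in\mathbf C^*$, $(\nabla\Omega(u)+\partial\Phi(u))^\top p$ means $\nabla\Omega(u)^\top p+\partial\langle p,\Phi(\cdot)\rangle(u)$. One has $\mathbf S^*=H^{-1}(0)=H_\gamma^{-1}(0)$, where $\mathcal F^{-1}(v)=\{w:v\in\mathcal F(w)\}$. A set-valued mapping $\mathcal F$ is metric subregular around $(w^*,0)$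 if there exist $\eta>0$ and $c_2>0$ such that $\mathrm{dist}(w,\mathcal F^{-1}(0))\le c_2\,\mathrm{dist}(0,\mathcal F(w))$ for all $w$ with $\|w-w^*\|\le\eta$.
   Formalization: In H and H_γ the subdifferentials of J and ⟨p,Φ⟩ are taken relative to U (of the function plus the indicator of U); with whole-space ∂ the claim fails when, e.g., ∂J is empty on dom J ∩ U, making subregularity vacuous. The maps agree under the usual sum rule. *)

theory Defs
  imports "HOL-Analysis.Analysis"
begin

section \<open>Extended-real-valued convex functions\<close>

definition ereal_convex :: "('a::real_vector \<Rightarrow> ereal) \<Rightarrow> bool" where
  "ereal_convex f \<longleftrightarrow>
     (\<forall>u v. \<forall>\<alpha>\<in>{0..1}. f (\<alpha> *\<^sub>R u + (1 - \<alpha>) *\<^sub>R v) \<le> ereal \<alpha> * f u + ereal (1 - \<alpha>) * f v)"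

definition lower_semicont :: "('a::topological_space \<Rightarrow> ereal) \<Rightarrow> bool" where
  "lower_semicont f \<longleftrightarrow> (\<forall>x. f x \<le> Liminf (at x) f)"

definition edom :: "('a \<Rightarrow> ereal) \<Rightarrow> 'a set" where
  "edom f = {u. f u < \<infinity>}"

definition normal_cone :: "'a::real_inner set \<Rightarrow> 'a \<Rightarrow> 'a set" where
  "normal_cone X x = {\<xi>. x \<in> X \<and> (\<forall>z\<in>X. \<xi> \<bullet> (z - x) \<le> 0)}"

text \<open>Convex subdifferential of \<open>f\<close> as a function on \<open>X\<close>, i.e. of \<open>f\<close> plus the indicator
  function of \<open>X\<close>; \<open>X = UNIV\<close> gives the subdifferential on the whole space. The KKT mappings
  below use \<open>X = U\<close>, since the constraint mapping is \<open>C\<close>-convex on \<open>U\<close> only. For a globally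
  convex \<open>f\<close> the elements of the normal cone of \<open>U\<close> absorbed in this way do not change the sum,
  in which that cone occurs anyway: by \<open>subdifferential_on_eq\<close> the two readings agree whenever
  the relative interiors of the domain of \<open>f\<close> and of \<open>U\<close> meet. If they do not meet, only
  the reading relative to \<open>U\<close> makes the zeros of the KKT mappings the saddle points.\<close>

definition subdifferential :: "'a::real_inner set \<Rightarrow> ('a \<Rightarrow> ereal) \<Rightarrow> 'a \<Rightarrow> 'a set" where
  "subdifferential X f u =
     {\<xi>. u \<in> X \<and> \<bar>f u\<bar> \<noteq> \<infinity> \<and> (\<forall>v\<in>X. f u + ereal (\<xi> \<bullet> (v - u)) \<le> f v)}"

lemma prolong_through_rel_interior:
  fixes S :: "'a::euclidean_space set"
  assumes "convex S" "z \<in> rel_interior S" "x \<in> S"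
  obtains t where "t > 0" "\<And>s. 0 \<le> s \<Longrightarrow> s \<le> t \<Longrightarrow> z + s *\<^sub>R (z - x) \<in> S"
proof -
  have "x \<in> affine hull S" using assms(3) by (simp add: hull_inc)
  then obtain m where m: "m > 1" "\<And>e. e > 1 \<Longrightarrow> e \<le> m \<Longrightarrow> (1 - e) *\<^sub>R x + e *\<^sub>R z \<in> S"
    using convex_rel_interior_if[OF assms(1,2)] by blast
  show thesis
  proof (rule that[of "m - 1"])
    show "m - 1 > 0" using m by simp
    fix s :: real assume s: "0 \<le> s" "s \<le> m - 1"
    show "z + s *\<^sub>R (z - x) \<in> S"
    proof (cases "s = 0")
      case True
      then show ?thesis using assms(2) rel_interior_subset by auto
    next
      case False
      have "(1 - (1 + s)) *\<^sub>R x + (1 + s) *\<^sub>R z \<in> S" using s False by (intro m(2)) auto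
      moreover have "(1 - (1 + s)) *\<^sub>R x + (1 + s) *\<^sub>R z = z + s *\<^sub>R (z - x)"
        by (simp add: algebra_simps)
      ultimately show ?thesis by simp
    qed
  qed
qed

lemma subdifferential_on_eq:
  fixes f :: "'a::euclidean_space \<Rightarrow> ereal"
  assumes conv: "ereal_convex f" and proper: "\<And>v. f v \<noteq> -\<infinity>"
    and U: "convex U" and ri: "rel_interior (edom f) \<inter> rel_interior U \<noteq> {}"
  shows "subdifferential U f u = {\<xi> + \<nu> |\<xi> \<nu>. \<xi> \<in> subdifferential UNIV f u \<and> \<nu> \<in> normal_cone U u}"
proof (intro equalityI subsetI)
  fix x assume "x \<in> {\<xi> + \<nu> |\<xi> \<nu>. \<xi> \<in> subdifferential UNIV f u \<and> \<nu> \<in> normal_cone U u}"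
  then obtain \<xi> \<nu> where x: "x = \<xi> + \<nu>" "\<xi> \<in> subdifferential UNIV f u" "\<nu> \<in> normal_cone U u"
    by blast
  have "f u + ereal (x \<bullet> (v - u)) \<le> f v" if "v \<in> U" for v
  proof -
    have "f u + ereal (x \<bullet> (v - u)) \<le> f u + ereal (\<xi> \<bullet> (v - u))"
      using x that by (intro add_left_mono) (auto simp: normal_cone_def inner_add_left)
    also have "\<dots> \<le> f v" using x by (auto simp: subdifferential_def)
    finally show ?thesis .
  qed
  then show "x \<in> subdifferential U f u"
    using x by (auto simp: subdifferential_def normal_cone_def)
next
  fix \<xi> assume \<xi>: "\<xi> \<in> subdifferential U f u"
  define A where "A = edom f"
  define g where "g v = real_of_ereal (f v)" for v
  have fg: "f v = ereal (g v)" if "v \<in> A" for v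
    using that proper[of v] unfolding A_def edom_def g_def by (cases "f v") auto
  have uU: "u \<in> U" and uA: "u \<in> A" using \<xi> by (auto simp: subdifferential_def A_def edom_def)
  have step: "\<alpha> *\<^sub>R v + (1 - \<alpha>) *\<^sub>R w \<in> A"
      "g (\<alpha> *\<^sub>R v + (1 - \<alpha>) *\<^sub>R w) \<le> \<alpha> * g v + (1 - \<alpha>) * g w"
    if "v \<in> A" "w \<in> A" "0 \<le> \<alpha>" "\<alpha> \<le> 1" for v w \<alpha>
  proof -
    have *: "f (\<alpha> *\<^sub>R v + (1 - \<alpha>) *\<^sub>R w) \<le> ereal (\<alpha> * g v + (1 - \<alpha>) * g w)"
      using conv that fg unfolding ereal_convex_def by (metis atLeastAtMost_iff plus_ereal.simps(1) times_ereal.simps(1))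
    then show i: "\<alpha> *\<^sub>R v + (1 - \<alpha>) *\<^sub>R w \<in> A"
      unfolding A_def edom_def by (auto intro: le_less_trans)
    show "g (\<alpha> *\<^sub>R v + (1 - \<alpha>) *\<^sub>R w) \<le> \<alpha> * g v + (1 - \<alpha>) * g w"
      using * fg[OF i] by simp
  qed
  have cA: "convex A"
    unfolding convex_alt by (metis add.commute step(1))
  define S where "S = {(x - y, s) |x y s. x \<in> A \<and> y \<in> U \<and> g x - \<xi> \<bullet> (y - u) \<le> s}"
  have SI: "(x - y, s) \<in> S" if "x \<in> A" "y \<in> U" "g x - \<xi> \<bullet> (y - u) \<le> s" for x y s
    using that unfolding S_def by blast
  have cS: "convex S"
  proof (rule convexI)
    fix p q and a b :: real
    assume "p \<in> S" "q \<in> S" and ab: "0 \<le> a" "0 \<le> b" "a + b = 1"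
    then obtain x y s x' y' s' where p: "p = (x - y, s)" "x \<in> A" "y \<in> U" "g x - \<xi> \<bullet> (y - u) \<le> s"
      and q: "q = (x' - y', s')" "x' \<in> A" "y' \<in> U" "g x' - \<xi> \<bullet> (y' - u) \<le> s'"
      unfolding S_def by blast
    have b: "b = 1 - a" using ab by simp
    have "(a *\<^sub>R x + b *\<^sub>R x' - (a *\<^sub>R y + b *\<^sub>R y'), a * s + b * s') \<in> S"
    proof (rule SI)
      show "a *\<^sub>R x + b *\<^sub>R x' \<in> A" using step(1) p q ab b by auto
      show "a *\<^sub>R y + b *\<^sub>R y' \<in> U" using U p q ab by (auto simp: convex_def)
      have "g (a *\<^sub>R x + b *\<^sub>R x') \<le> a * g x + b * g x'" using step(2) p q ab b by auto
      moreover have "a *\<^sub>R y + b *\<^sub>R y' - u = a *\<^sub>R (y - u) + b *\<^sub>R (y' - u)"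
        by (simp add: b algebra_simps)
      then have "\<xi> \<bullet> (a *\<^sub>R y + b *\<^sub>R y' - u) = a * (\<xi> \<bullet> (y - u)) + b * (\<xi> \<bullet> (y' - u))"
        by (metis inner_add_right inner_scaleR_right)
      moreover have "a * (g x - \<xi> \<bullet> (y - u)) + b * (g x' - \<xi> \<bullet> (y' - u)) \<le> a * s + b * s'"
        using p q ab by (intro add_mono mult_left_mono) auto
      ultimately show "g (a *\<^sub>R x + b *\<^sub>R x') - \<xi> \<bullet> (a *\<^sub>R y + b *\<^sub>R y' - u) \<le> a * s + b * s'"
        by (simp add: algebra_simps)
    qed
    moreover have "a *\<^sub>R p + b *\<^sub>R q = (a *\<^sub>R x + b *\<^sub>R x' - (a *\<^sub>R y + b *\<^sub>R y'), a * s + b * s')"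
      by (simp add: p q algebra_simps)
    ultimately show "a *\<^sub>R p + b *\<^sub>R q \<in> S" by simp
  qed
  have S0: "s \<ge> g u" if s: "(0, s) \<in> S" for s
  proof -
    obtain x y where "x - y = 0" "x \<in> A" and y: "y \<in> U" "g x - \<xi> \<bullet> (y - u) \<le> s"
      using s unfolding S_def by force
    then have y: "y \<in> A" "y \<in> U" "g y - \<xi> \<bullet> (y - u) \<le> s" by auto
    have "f u + ereal (\<xi> \<bullet> (y - u)) \<le> f y" using \<xi> y by (auto simp: subdifferential_def)
    then have "g u + \<xi> \<bullet> (y - u) \<le> g y" using fg uA y by simp
    then show ?thesis using y by simp
  qed
  have inS: "(0, s) \<in> S" if "s \<ge> g u" for s
    using SI[of u u s] uA uU that by simp
  have nri: "(0, g u) \<notin> rel_interior S"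
  proof
    assume r: "(0, g u) \<in> rel_interior S"
    have i: "(0, g u + 1) \<in> S" by (rule inS) simp
    obtain t where t: "t > 0"
      "\<And>s. 0 \<le> s \<Longrightarrow> s \<le> t \<Longrightarrow> (0, g u) + s *\<^sub>R ((0, g u) - (0, g u + 1)) \<in> S"
      using prolong_through_rel_interior[OF cS r i] by blast
    have "(0, g u - t) \<in> S" using t(2)[of t] t(1) by simp
    then show False using S0 t(1) by fastforce
  qed
  obtain c where c: "\<And>y. y \<in> S \<Longrightarrow> c \<bullet> (0, g u) \<le> c \<bullet> y"
      "\<And>y. y \<in> rel_interior S \<Longrightarrow> c \<bullet> (0, g u) < c \<bullet> y"
    using supporting_hyperplane_rel_boundary[OF cS inS[OF order_refl] nri] by metis
  obtain a b where ab: "c = (a, b)" by (cases c)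
  have "b \<ge> 0" using c(1)[OF inS[of "g u + 1"]] by (simp add: ab algebra_simps)
  moreover have "b \<noteq> 0"
  proof
    assume b: "b = 0"
    obtain z where z: "z \<in> rel_interior A" "z \<in> rel_interior U" using ri by (auto simp: A_def)
    have nn: "a \<bullet> (x - y) \<ge> 0" if "x \<in> A" "y \<in> U" for x y
      using c(1)[OF SI[OF that order_refl]] by (simp add: ab b)
    have zero: "a \<bullet> (x - y) = 0" if xy: "x \<in> A" "y \<in> U" for x y
    proof -
      obtain t1 where t1: "t1 > 0" "\<And>s. 0 \<le> s \<Longrightarrow> s \<le> t1 \<Longrightarrow> z + s *\<^sub>R (z - x) \<in> A"
        using prolong_through_rel_interior[OF cA z(1) xy(1)] by blast
      obtain t2 where t2: "t2 > 0" "\<And>s. 0 \<le> s \<Longrightarrow> s \<le> t2 \<Longrightarrow> z + s *\<^sub>R (z - y) \<in> U"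
        using prolong_through_rel_interior[OF U z(2) xy(2)] by blast
      define t where "t = min t1 t2"
      have t: "t > 0" using t1 t2 by (simp add: t_def)
      have "a \<bullet> ((z + t *\<^sub>R (z - x)) - (z + t *\<^sub>R (z - y))) \<ge> 0"
        using t by (intro nn t1 t2) (auto simp: t_def)
      also have "(z + t *\<^sub>R (z - x)) - (z + t *\<^sub>R (z - y)) = - (t *\<^sub>R (x - y))"
        by (simp add: algebra_simps)
      finally have "t * (a \<bullet> (x - y)) \<le> 0" by simp
      then have "a \<bullet> (x - y) \<le> 0" using t by (simp add: mult_le_0_iff)
      then show ?thesis using nn[OF xy] by simp
    qed
    have "rel_interior S \<noteq> {}" using cS inS[OF order_refl] rel_interior_eq_empty by blast
    then obtain w where w: "w \<in> rel_interior S" by blast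
    then have "w \<in> S" using rel_interior_subset by blast
    then have "c \<bullet> w = 0" using zero by (auto simp: S_def ab b)
    then show False using c(2)[OF w] by (simp add: ab b)
  qed
  ultimately have b: "b > 0" by simp
  have key: "b * g u \<le> a \<bullet> (x - y) + b * (g x - \<xi> \<bullet> (y - u))" if "x \<in> A" "y \<in> U" for x y
    using c(1)[OF SI[OF that order_refl]] by (simp add: ab)
  define \<xi>1 where "\<xi>1 = - (a /\<^sub>R b)"
  have a: "a = - (b *\<^sub>R \<xi>1)" using b by (simp add: \<xi>1_def)
  have 1: "\<xi>1 \<in> subdifferential UNIV f u"
  proof -
    have "f u + ereal (\<xi>1 \<bullet> (v - u)) \<le> f v" for v
    proof (cases "v \<in> A")
      case True
      have "b * (g u + \<xi>1 \<bullet> (v - u)) \<le> b * g v"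
        using key[OF True uU] by (simp add: a algebra_simps)
      then show ?thesis using b fg uA True by simp
    next
      case False
      then show ?thesis by (simp add: A_def edom_def)
    qed
    then show ?thesis using fg[OF uA] by (simp add: subdifferential_def)
  qed
  have 2: "\<xi> - \<xi>1 \<in> normal_cone U u"
  proof -
    have "(\<xi> - \<xi>1) \<bullet> (y - u) \<le> 0" if "y \<in> U" for y
    proof -
      have "b * ((\<xi> - \<xi>1) \<bullet> (y - u)) \<le> b * 0"
        using key[OF uA that] by (simp add: a algebra_simps)
      then show ?thesis using b mult_le_cancel_left_pos by blast
    qed
    then show ?thesis using uU by (simp add: normal_cone_def)
  qed
  have "\<xi> = \<xi>1 + (\<xi> - \<xi>1)" by simp
  then show "\<xi> \<in> {\<xi> + \<nu> |\<xi> \<nu>. \<xi> \<in> subdifferential UNIV f u \<and> \<nu> \<in> normal_cone U u}"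
    using 1 2 by blast
qed


section \<open>Smooth functions\<close>

definition gradient :: "('a::real_inner \<Rightarrow> real) \<Rightarrow> 'a \<Rightarrow> 'a" where
  "gradient f x = (THE D. GDERIV f x :> D)"

definition strongly_convex_on :: "'a::real_inner set \<Rightarrow> real \<Rightarrow> ('a \<Rightarrow> real) \<Rightarrow> bool" where
  "strongly_convex_on X \<beta> K \<longleftrightarrow>
     (\<forall>u\<in>X. \<forall>v\<in>X. \<forall>\<alpha>\<in>{0..1}. K (\<alpha> *\<^sub>R u + (1 - \<alpha>) *\<^sub>R v)
        \<le> \<alpha> * K u + (1 - \<alpha>) * K v - \<beta> / 2 * \<alpha> * (1 - \<alpha>) * (norm (u - v))\<^sup>2)"

definition bregman :: "('a::real_inner \<Rightarrow> real) \<Rightarrow> 'a \<Rightarrow> 'a \<Rightarrow> real" where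
  "bregman K u v = K u - K v - gradient K v \<bullet> (u - v)"


section \<open>The cone-constrained problem\<close>

definition dual_cone :: "'a::real_inner set \<Rightarrow> 'a set" where
  "dual_cone C = {y. \<forall>x\<in>C. 0 \<le> y \<bullet> x}"

definition cone_convex_on ::
    "'b::real_vector set \<Rightarrow> 'a::real_vector set \<Rightarrow> ('a \<Rightarrow> 'b) \<Rightarrow> bool" where
  "cone_convex_on C U F \<longleftrightarrow> (\<forall>u\<in>U. \<forall>v\<in>U. \<forall>\<alpha>\<in>{0..1}.
     F (\<alpha> *\<^sub>R u + (1 - \<alpha>) *\<^sub>R v) - \<alpha> *\<^sub>R F u - (1 - \<alpha>) *\<^sub>R F v \<in> uminus ` C)"

definition lagrangian ::
    "('a \<Rightarrow> real) \<Rightarrow> ('a \<Rightarrow> ereal) \<Rightarrow> ('a \<Rightarrow> 'b::real_inner) \<Rightarrow> 'a \<Rightarrow> 'b \<Rightarrow> ereal" where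
  "lagrangian G J \<Theta> u p = ereal (G u) + J u + ereal (p \<bullet> \<Theta> u)"

definition saddle_points ::
    "('a \<Rightarrow> real) \<Rightarrow> ('a \<Rightarrow> ereal) \<Rightarrow> ('a \<Rightarrow> 'b::real_inner) \<Rightarrow> 'a set \<Rightarrow> 'b set \<Rightarrow> ('a \<times> 'b) set" where
  "saddle_points G J \<Theta> U C = {(us, ps). us \<in> U \<and> ps \<in> dual_cone C \<and>
     (\<forall>u\<in>U. \<forall>p\<in>dual_cone C. lagrangian G J \<Theta> us p \<le> lagrangian G J \<Theta> us ps \<and>
        lagrangian G J \<Theta> us ps \<le> lagrangian G J \<Theta> u ps)}"

definition vapp_objective ::
    "('a::real_inner \<Rightarrow> real) \<Rightarrow> ('a \<Rightarrow> ereal) \<Rightarrow> ('a \<Rightarrow> 'b::real_inner) \<Rightarrow> ('a \<Rightarrow> 'b) \<Rightarrow>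
      ('a \<Rightarrow> real) \<Rightarrow> real \<Rightarrow> 'a \<Rightarrow> 'b \<Rightarrow> 'a \<Rightarrow> ereal" where
  "vapp_objective G J \<Omega> \<Phi> K \<epsilon> uk qk u =
     ereal (gradient G uk \<bullet> u) + J u
     + ereal (qk \<bullet> (frechet_derivative \<Omega> (at uk) u + \<Phi> u))
     + ereal (1 / \<epsilon> * bregman K u uk)"


section \<open>KKT mappings and metric subregularity\<close>

definition kkt_stationarity ::
    "('a::euclidean_space \<Rightarrow> real) \<Rightarrow> ('a \<Rightarrow> ereal) \<Rightarrow> ('a \<Rightarrow> 'b::euclidean_space) \<Rightarrow> ('a \<Rightarrow> 'b) \<Rightarrow>
      'a set \<Rightarrow> 'a \<Rightarrow> 'b \<Rightarrow> 'a set" where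
  "kkt_stationarity G J \<Omega> \<Phi> U u q =
     {gradient G u + \<xi> + (adjoint (frechet_derivative \<Omega> (at u)) q + \<zeta>) + \<nu> |\<xi> \<zeta> \<nu>.
        \<xi> \<in> subdifferential U J u \<and> \<zeta> \<in> subdifferential U (\<lambda>v. ereal (q \<bullet> \<Phi> v)) u \<and>
        \<nu> \<in> normal_cone U u}"

definition kkt_map ::
    "('a::euclidean_space \<Rightarrow> real) \<Rightarrow> ('a \<Rightarrow> ereal) \<Rightarrow> ('a \<Rightarrow> 'b::euclidean_space) \<Rightarrow> ('a \<Rightarrow> 'b) \<Rightarrow>
      'a set \<Rightarrow> 'b set \<Rightarrow> 'a \<times> 'b \<Rightarrow> ('a \<times> 'b) set" where
  "kkt_map G J \<Omega> \<Phi> U C = (\<lambda>(u, p).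
     kkt_stationarity G J \<Omega> \<Phi> U u p \<times>
     {- (\<Omega> u + \<Phi> u) + \<mu> |\<mu>. \<mu> \<in> normal_cone (dual_cone C) p})"

definition kkt_map_aug ::
    "real \<Rightarrow> ('a::euclidean_space \<Rightarrow> real) \<Rightarrow> ('a \<Rightarrow> ereal) \<Rightarrow> ('a \<Rightarrow> 'b::euclidean_space) \<Rightarrow>
      ('a \<Rightarrow> 'b) \<Rightarrow> 'a set \<Rightarrow> 'b set \<Rightarrow> 'a \<times> 'b \<Rightarrow> ('a \<times> 'b) set" where
  "kkt_map_aug \<gamma> G J \<Omega> \<Phi> U C = (\<lambda>(u, p).
     kkt_stationarity G J \<Omega> \<Phi> U u (closest_point (dual_cone C) (p + \<gamma> *\<^sub>R (\<Omega> u + \<Phi> u))) \<times>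
     {- (\<Omega> u + \<Phi> u) + \<mu> |\<mu>. \<mu> \<in> normal_cone (dual_cone C) p})"

text \<open>Unlike \<^const>\<open>infdist\<close> and \<^const>\<open>setdist\<close>, this distance is \<open>\<infinity>\<close> for the empty set.\<close>

definition dist_to_set :: "'a::metric_space \<Rightarrow> 'a set \<Rightarrow> ereal" where
  "dist_to_set x S = (INF s\<in>S. ereal (dist x s))"

definition metric_subregular_at_zero ::
    "('a::real_normed_vector \<Rightarrow> 'b::real_normed_vector set) \<Rightarrow> 'a \<Rightarrow> bool" where
  "metric_subregular_at_zero F ws \<longleftrightarrow> (\<exists>\<eta>>0. \<exists>c\<^sub>2>0. \<forall>w. norm (w - ws) \<le> \<eta> \<longrightarrow>
     dist_to_set w {v. 0 \<in> F v} \<le> ereal c\<^sub>2 * dist_to_set 0 (F w))"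

end

theory Submission
  imports Defs
begin

text \<open>
  A VAPP step is a perturbed solution of the KKT system. The optimality condition of the subproblem
  and the variational inequality of the projection that defines \<open>p (Suc k)\<close> together exhibit an
  element \<open>h\<close> of the KKT mapping at the new iterate, and every term of \<open>h\<close> is controlled by the
  change of the data from the old to the new iterate. These data are Lipschitz and \<open>\<epsilon> k \<ge> \<epsilon>_lo\<close>, so
  \<open>norm h\<close> is at most a constant times the length of the step
  (\<open>vapp_stationarity_residual\<close>, \<open>closest_point_residual_in_normal_cone\<close>). Metric
  subregularity turns this residual into a bound on the distance to the zeros of the mapping, and
  these zeros are saddle points (\<open>kkt_zero_imp_saddle_point\<close>).

  The delicate point is the nonsmooth term. The subproblem yields a subgradient of the sum
  \<open>J + q k \<bullet> \<Phi>\<close>, with the multiplier \<open>q k\<close>, whereas the KKT mappings ask for separate subgradients of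
  \<open>J\<close> and of \<open>r \<bullet> \<Phi>\<close>, where \<open>r\<close> is \<open>p (Suc k)\<close> for the first mapping and a projected multiplier
  for the second. Two observations bridge the gap. Since \<open>q k\<close> and \<open>r\<close> are close, the functions
  \<open>q k \<bullet> \<Phi>\<close> and \<open>r \<bullet> \<Phi>\<close> differ by a function with a small Lipschitz constant \<open>\<delta>\<close>; this difference
  is dominated by the convex function \<open>x \<mapsto> \<delta> * norm (x - u)\<close>, whose subgradients have norm at
  most \<open>\<delta>\<close>. And the sum rule for subdifferentials holds as soon as one summand is Lipschitz
  (\<open>subgradient_sum_lipschitz\<close>); both facts are combined in \<open>perturbed_subgradient_split\<close>.

  That \<open>\<Phi>\<close> is Lipschitz on \<open>U\<close> follows from \<open>\<Phi> = \<Theta> - \<Omega>\<close>: the constraint map \<open>\<Theta>\<close> is Lipschitz by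
  assumption, and \<open>\<Omega>\<close> has the same derivative at all points of \<open>U\<close>
  (\<open>frechet_derivative_constant_on\<close>), because the gradient of \<open>r \<bullet> \<Omega>\<close> is linear in \<open>r\<close> but
  has a Lipschitz constant that does not depend on \<open>r\<close>.
\<close>

section \<open>Gradients and first-order inequalities\<close>

lemma GDERIV_gradient:
  fixes f :: "'a::euclidean_space \<Rightarrow> real"
  assumes "f differentiable (at x)"
  shows "GDERIV f x :> gradient f x"
proof -
  obtain D where D: "(f has_derivative D) (at x)"
    using assms by (auto simp: differentiable_def)
  have "linear D" using D by (rule has_derivative_linear)
  then have "D h = h \<bullet> adjoint D 1" for h
    by (simp add: adjoint_works)
  then have "GDERIV f x :> adjoint D 1"
    using D unfolding gderiv_def by (metis (no_types, lifting) ext)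
  moreover have "D1 = D2" if "GDERIV f x :> D1" "GDERIV f x :> D2" for D1 D2
  proof -
    have "(\<lambda>h. h \<bullet> D1) = (\<lambda>h. h \<bullet> D2)"
      using that unfolding gderiv_def by (rule has_derivative_unique)
    then show ?thesis by (metis vector_eq_ldot)
  qed
  ultimately show ?thesis unfolding gradient_def by (blast intro: theI)
qed

lemma has_derivative_gradient:
  fixes f :: "'a::euclidean_space \<Rightarrow> real"
  assumes "f differentiable (at x)"
  shows "(f has_derivative (\<lambda>h. gradient f x \<bullet> h)) (at x)"
  using GDERIV_gradient[OF assms] by (simp add: gderiv_def inner_commute)

lemma inner_adjoint_frechet_derivative:
  fixes F :: "'a::euclidean_space \<Rightarrow> 'b::euclidean_space"
  assumes "F differentiable (at x)"
  shows "adjoint (frechet_derivative F (at x)) r \<bullet> h = r \<bullet> frechet_derivative F (at x) h"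
  using adjoint_works[OF linear_frechet_derivative[OF assms]] by (simp add: inner_commute)

lemma has_derivative_inner_adjoint:
  fixes F :: "'a::euclidean_space \<Rightarrow> 'b::euclidean_space"
  assumes "F differentiable (at x)"
  shows "((\<lambda>v. r \<bullet> F v) has_derivative
    (\<lambda>h. adjoint (frechet_derivative F (at x)) r \<bullet> h)) (at x)"
  unfolding inner_adjoint_frechet_derivative[OF assms]
  using assms unfolding frechet_derivative_works by (rule has_derivative_inner_right)

lemma gradient_inner_eq_adjoint:
  fixes F :: "'a::euclidean_space \<Rightarrow> 'b::euclidean_space"
  assumes "F differentiable (at x)"
  shows "gradient (\<lambda>v. r \<bullet> F v) x = adjoint (frechet_derivative F (at x)) r"
proof -
  have D: "((\<lambda>v. r \<bullet> F v) has_derivative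
      (\<lambda>h. adjoint (frechet_derivative F (at x)) r \<bullet> h)) (at x)"
    using assms by (rule has_derivative_inner_adjoint)
  then have "(\<lambda>v. r \<bullet> F v) differentiable (at x)" by (auto simp: differentiable_def)
  from has_derivative_unique[OF has_derivative_gradient[OF this] D]
  show ?thesis by (metis vector_eq_rdot)
qed

text \<open>At a minimizer, the smooth part may be replaced by its linearization while the convex part is
  kept: along the segment from \<open>x\<close> to \<open>v\<close>, convexity bounds \<open>\<phi>\<close> by its chord, and the right
  derivative at \<open>x\<close> of \<open>s\<close> plus this chord cannot be negative.\<close>
lemma minimizer_smooth_plus_convex:
  fixes s :: "'a::real_normed_vector \<Rightarrow> real"
  assumes A: "convex_on A \<phi>" "x \<in> A" "v \<in> A"
    and s: "(s has_derivative D) (at x)"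
    and min: "\<And>y. y \<in> A \<Longrightarrow> s x + \<phi> x \<le> s y + \<phi> y"
  shows "\<phi> x \<le> \<phi> v + D (v - x)"
proof (rule ccontr)
  assume "\<not> ?thesis"
  then have neg: "D (v - x) + (\<phi> v - \<phi> x) < 0" by simp
  define h where "h t = s (x + t *\<^sub>R (v - x)) + t * (\<phi> v - \<phi> x)" for t
  have lin: "linear D" using s by (rule has_derivative_linear)
  have "((\<lambda>t. s (x + t *\<^sub>R (v - x))) has_derivative (\<lambda>t. D (t *\<^sub>R (v - x)))) (at 0)"
    by (rule has_derivative_compose[where g=s and f="\<lambda>t. x + t *\<^sub>R (v - x)"])
       (auto intro!: derivative_eq_intros simp: s)
  then have "(h has_derivative (\<lambda>t. D (t *\<^sub>R (v - x)) + t * (\<phi> v - \<phi> x))) (at 0)"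
    unfolding h_def by (auto intro!: derivative_eq_intros)
  then have "DERIV h 0 :> D (v - x) + (\<phi> v - \<phi> x)"
    unfolding has_field_derivative_def
    by (rule has_derivative_eq_rhs)
       (simp add: linear_scale[OF lin] fun_eq_iff algebra_simps del: scaleR_right_diff_distrib)
  from DERIV_neg_dec_right[OF this neg]
  obtain d where d: "d > 0" "\<And>t. 0 < t \<Longrightarrow> t < d \<Longrightarrow> h t < h 0" by auto
  define t where "t = min (d / 2) 1"
  have t: "0 < t" "t < d" "t \<le> 1" using d(1) by (auto simp: t_def)
  have eq: "x + t *\<^sub>R (v - x) = (1 - t) *\<^sub>R x + t *\<^sub>R v" by (simp add: algebra_simps)
  have "x + t *\<^sub>R (v - x) \<in> A"
    unfolding eq using convex_on_imp_convex[OF A(1)] A t by (intro convexD) auto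
  then have "s x + \<phi> x \<le> s (x + t *\<^sub>R (v - x)) + \<phi> (x + t *\<^sub>R (v - x))" by (rule min)
  also have "\<phi> (x + t *\<^sub>R (v - x)) \<le> (1 - t) * \<phi> x + t * \<phi> v"
    unfolding eq using A t by (intro convex_onD) auto
  finally have "h 0 \<le> h t" by (simp add: h_def algebra_simps)
  then show False using d(2)[of t] t by simp
qed

text \<open>Every point minimizes \<open>f - f\<close>, and \<open>minimizer_smooth_plus_convex\<close> linearizes the second
  copy only.\<close>
lemma convex_on_tangent_below:
  fixes f :: "'a::real_normed_vector \<Rightarrow> real"
  assumes "convex_on A f" "x \<in> A" "v \<in> A" "(f has_derivative D) (at x)"
  shows "f x + D (v - x) \<le> f v"
  using minimizer_smooth_plus_convex[OF assms(1-3) has_derivative_minus[OF assms(4)]] by simp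


section \<open>A subdifferential sum rule\<close>

text \<open>Lipschitz continuity of \<open>f\<close> up to the boundary of \<open>X\<close> takes the place of a condition on
  relative interiors. In the space of pairs \<open>(d, s)\<close>, the set \<open>S\<close> collects the values that
  \<open>g x + f y - a \<bullet> (x - u)\<close> can take or exceed when the two arguments are allowed to differ by
  \<open>d = x - y\<close>. As \<open>f\<close> is \<open>L\<close>-Lipschitz, such a value is at least \<open>c - L * norm d\<close>, where \<open>c\<close> is
  the value at \<open>x = y = u\<close>. Hence \<open>S\<close> is disjoint from the full-dimensional set \<open>T\<close> below this
  cone. The slope \<open>\<mu>\<close> of a hyperplane between them is how much has to be moved from one summand
  to the other.\<close>
lemma subgradient_sum_lipschitz:
  fixes f g :: "'a::euclidean_space \<Rightarrow> real"
  assumes g: "convex_on A g" and f: "convex_on X f" and AX: "A \<subseteq> X"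
    and lip: "L-lipschitz_on X f" and u: "u \<in> A"
    and sub: "\<And>x. x \<in> A \<Longrightarrow> g u + f u + a \<bullet> (x - u) \<le> g x + f x"
  obtains \<xi> \<zeta> where "a = \<xi> + \<zeta>" "\<And>x. x \<in> A \<Longrightarrow> g u + \<xi> \<bullet> (x - u) \<le> g x"
    "\<And>x. x \<in> X \<Longrightarrow> f u + \<zeta> \<bullet> (x - u) \<le> f x"
proof -
  define c where "c = g u + f u"
  define S where "S = {(x - y, s) |x y s. x \<in> A \<and> y \<in> X \<and> g x + f y - a \<bullet> (x - u) \<le> s}"
  define T where "T = {(d::'a, s). s < c - L * norm d}"
  have L: "L \<ge> 0" using lip by (rule lipschitz_on_nonneg)
  have SI: "(x - y, s) \<in> S" if "x \<in> A" "y \<in> X" "g x + f y - a \<bullet> (x - u) \<le> s" for x y s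
    using that unfolding S_def by blast
  have "convex S"
  proof (rule convexI)
    fix P Q and m n :: real
    assume "P \<in> S" "Q \<in> S" and mn: "0 \<le> m" "0 \<le> n" "m + n = 1"
    then obtain x y s x' y' s' where
      P: "P = (x - y, s)" "x \<in> A" "y \<in> X" "g x + f y - a \<bullet> (x - u) \<le> s" and
      Q: "Q = (x' - y', s')" "x' \<in> A" "y' \<in> X" "g x' + f y' - a \<bullet> (x' - u) \<le> s'"
      unfolding S_def by blast
    have m: "m = 1 - n" using mn by simp
    have "(m *\<^sub>R x + n *\<^sub>R x' - (m *\<^sub>R y + n *\<^sub>R y'), m * s + n * s') \<in> S"
    proof (rule SI)
      show "m *\<^sub>R x + n *\<^sub>R x' \<in> A"
        using convex_on_imp_convex[OF g] P Q mn by (auto simp: convex_def)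
      show "m *\<^sub>R y + n *\<^sub>R y' \<in> X"
        using convex_on_imp_convex[OF f] P Q mn by (auto simp: convex_def)
      have "g (m *\<^sub>R x + n *\<^sub>R x') \<le> m * g x + n * g x'"
        unfolding m using P Q mn by (intro convex_onD[OF g]) auto
      moreover have "f (m *\<^sub>R y + n *\<^sub>R y') \<le> m * f y + n * f y'"
        unfolding m using P Q mn by (intro convex_onD[OF f]) auto
      moreover have "m *\<^sub>R x + n *\<^sub>R x' - u = m *\<^sub>R (x - u) + n *\<^sub>R (x' - u)"
        by (simp add: m algebra_simps)
      then have "a \<bullet> (m *\<^sub>R x + n *\<^sub>R x' - u) = m * (a \<bullet> (x - u)) + n * (a \<bullet> (x' - u))"
        by (metis inner_add_right inner_scaleR_right)
      moreover have "m * (g x + f y - a \<bullet> (x - u)) + n * (g x' + f y' - a \<bullet> (x' - u))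
          \<le> m * s + n * s'"
        using P Q mn by (intro add_mono mult_left_mono) auto
      ultimately show "g (m *\<^sub>R x + n *\<^sub>R x') + f (m *\<^sub>R y + n *\<^sub>R y')
          - a \<bullet> (m *\<^sub>R x + n *\<^sub>R x' - u) \<le> m * s + n * s'"
        by (simp add: algebra_simps)
    qed
    moreover have "m *\<^sub>R P + n *\<^sub>R Q
        = (m *\<^sub>R x + n *\<^sub>R x' - (m *\<^sub>R y + n *\<^sub>R y'), m * s + n * s')"
      by (simp add: P Q algebra_simps)
    ultimately show "m *\<^sub>R P + n *\<^sub>R Q \<in> S" by simp
  qed
  moreover have "convex T"
  proof (rule convexI)
    fix P Q and m n :: real
    assume "P \<in> T" "Q \<in> T" and mn: "0 \<le> m" "0 \<le> n" "m + n = 1"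
    then obtain d s d' s' where P: "P = (d, s)" "s < c - L * norm d"
      and Q: "Q = (d', s')" "s' < c - L * norm d'"
      unfolding T_def by blast
    have "m * s + n * s' < m * (c - L * norm d) + n * (c - L * norm d')"
    proof (cases "m = 0")
      case False
      then have "m * s < m * (c - L * norm d)" using P mn by simp
      moreover have "n * s' \<le> n * (c - L * norm d')" using Q mn by (intro mult_left_mono) auto
      ultimately show ?thesis by simp
    qed (use Q mn in auto)
    also have "\<dots> = (m + n) * c - L * (m * norm d + n * norm d')" by (simp add: algebra_simps)
    also have "\<dots> \<le> c - L * norm (m *\<^sub>R d + n *\<^sub>R d')"
      using norm_triangle_ineq[of "m *\<^sub>R d" "n *\<^sub>R d'"] mn L by (auto intro!: mult_left_mono)
    finally show "m *\<^sub>R P + n *\<^sub>R Q \<in> T" by (simp add: T_def P Q)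
  qed
  moreover have "(0, c) \<in> S" using SI[of u u c] u AX by (auto simp: c_def)
  moreover have T0: "(0, s) \<in> T" if "s < c" for s using that by (simp add: T_def)
  moreover have "S \<inter> T = {}"
  proof -
    have "c - L * norm (x - y) \<le> s"
      if "x \<in> A" "y \<in> X" "g x + f y - a \<bullet> (x - u) \<le> s" for x y s
    proof -
      have "\<bar>f x - f y\<bar> \<le> L * norm (x - y)"
        using lipschitz_onD[OF lip] that AX by (metis dist_norm real_norm_def subsetD)
      then show ?thesis using sub[OF that(1)] that(3) by (simp add: c_def)
    qed
    then show ?thesis by (force simp: S_def T_def)
  qed
  ultimately obtain n \<kappa> where n: "n \<noteq> 0" "\<And>z. z \<in> S \<Longrightarrow> n \<bullet> z \<le> \<kappa>" "\<And>z. z \<in> T \<Longrightarrow> n \<bullet> z \<ge> \<kappa>"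
    using separating_hyperplane_sets[of S T] by (metis emptyE lt_ex)
  obtain \<alpha> b where nab: "n = (\<alpha>, b)" by (cases n)
  have Sc: "b * c \<le> \<kappa>" using n(2)[OF \<open>(0, c) \<in> S\<close>] by (simp add: nab)
  have "\<kappa> \<le> b * (c - 1)" using n(3)[OF T0[of "c - 1"]] by (simp add: nab)
  then have "b \<le> 0" using Sc by (simp add: algebra_simps)
  \<comment> \<open>The projection of \<open>T\<close> to the first component is the whole space, on which a nonzero
    functional is unbounded.\<close>
  moreover have "b \<noteq> 0"
  proof
    assume b: "b = 0"
    have "\<kappa> \<le> \<alpha> \<bullet> d" for d
      using n(3)[of "(d, c - L * norm d - 1)"] by (simp add: nab b T_def)
    moreover have "\<kappa> \<ge> 0" using Sc b by simp
    ultimately have "\<alpha> \<bullet> (- \<alpha>) \<ge> 0" by (metis order_trans)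
    then have "\<alpha> = 0" by (metis inner_ge_zero inner_eq_zero_iff inner_minus_right
          neg_0_le_iff_le order_antisym)
    then show False using n(1) by (simp add: nab b zero_prod_def)
  qed
  ultimately have b: "b < 0" by simp
  have Tc: "\<kappa> \<le> b * c"
  proof (rule field_le_epsilon)
    fix e :: real assume e: "e > 0"
    then show "\<kappa> \<le> b * c + e"
      using n(3)[OF T0[of "c + e / b"]] b divide_pos_neg[of e b] by (simp add: nab distrib_left)
  qed
  define \<mu> where "\<mu> = \<alpha> /\<^sub>R (- b)"
  have \<alpha>: "\<alpha> = (- b) *\<^sub>R \<mu>" using b by (simp add: \<mu>_def)
  have key: "c + \<mu> \<bullet> (x - y) \<le> g x + f y - a \<bullet> (x - u)" if "x \<in> A" "y \<in> X" for x y
  proof -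
    have "\<alpha> \<bullet> (x - y) + b * (g x + f y - a \<bullet> (x - u)) \<le> b * c"
      using n(2)[OF SI[OF that order_refl]] Tc by (simp add: nab)
    then have "b * (g x + f y - a \<bullet> (x - u)) \<le> b * (c + \<mu> \<bullet> (x - y))"
      unfolding \<alpha> by (simp add: algebra_simps)
    then show ?thesis using b by (simp add: mult_le_cancel_left)
  qed
  show thesis
  proof (rule that[of "a + \<mu>" "- \<mu>"])
    show "g u + (a + \<mu>) \<bullet> (x - u) \<le> g x" if "x \<in> A" for x
      using key[OF that, of u] u AX by (auto simp: c_def inner_add_left)
    show "f u + (- \<mu>) \<bullet> (x - u) \<le> f x" if "x \<in> X" for x
      using key[OF u that] by (simp add: c_def inner_diff_right)
  qed simp
qed

lemma convex_on_real_of_ereal: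
  assumes J: "\<And>v. J v \<noteq> -\<infinity>" "ereal_convex J" and X: "convex X"
  shows "convex_on (edom J \<inter> X) (\<lambda>v. real_of_ereal (J v))"
proof -
  have fin: "J v = ereal (real_of_ereal (J v))" if "v \<in> edom J" for v
    using that J(1)[of v] by (cases "J v") (auto simp: edom_def)
  have step: "J ((1 - t) *\<^sub>R x + t *\<^sub>R y)
      \<le> ereal ((1 - t) * real_of_ereal (J x) + t * real_of_ereal (J y))"
    if "x \<in> edom J" "y \<in> edom J" "0 \<le> t" "t \<le> 1" for x y t
  proof -
    have "1 - t \<in> {0..1}" using that by simp
    then have "J ((1 - t) *\<^sub>R x + (1 - (1 - t)) *\<^sub>R y)
        \<le> ereal (1 - t) * J x + ereal (1 - (1 - t)) * J y"
      using J(2) unfolding ereal_convex_def by blast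
    also have "\<dots> = ereal ((1 - t) * real_of_ereal (J x) + t * real_of_ereal (J y))"
      by (subst fin[OF that(1)], subst fin[OF that(2)]) simp
    finally show ?thesis by simp
  qed
  have dom: "(1 - t) *\<^sub>R x + t *\<^sub>R y \<in> edom J"
    if "x \<in> edom J" "y \<in> edom J" "0 \<le> t" "t \<le> 1" for x y t
    using step[OF that] by (auto simp: edom_def intro: le_less_trans)
  show ?thesis
  proof (rule convex_onI)
    show "convex (edom J \<inter> X)"
      unfolding convex_alt using dom X by (auto simp: convex_alt)
    fix t x y assume "0 < (t::real)" "t < 1" "x \<in> edom J \<inter> X" "y \<in> edom J \<inter> X"
    then have xy: "x \<in> edom J" "y \<in> edom J" "0 \<le> t" "t \<le> 1" by auto
    show "real_of_ereal (J ((1 - t) *\<^sub>R x + t *\<^sub>R y))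
        \<le> (1 - t) * real_of_ereal (J x) + t * real_of_ereal (J y)"
      using step[OF xy] fin[OF dom[OF xy]] by (metis ereal_less_eq(3))
  qed
qed

text \<open>A subgradient of \<open>J + \<psi>\<close> splits, up to an error \<open>\<delta>\<close>, into subgradients of \<open>J\<close> and of a
  convex function \<open>\<phi>\<close> close to \<open>\<psi>\<close>, although \<open>\<psi> - \<phi>\<close> may be far from convex: it is bounded by
  \<open>\<delta> * norm (x - u)\<close> up to its value at \<open>u\<close>, so the given subgradient is one of
  \<open>J + \<phi> + \<delta> * norm (x - u)\<close>, and the sum rule applies twice. The share of the last summand is
  the error.\<close>
lemma perturbed_subgradient_split:
  fixes J :: "'a::euclidean_space \<Rightarrow> ereal" and \<phi> \<psi> :: "'a \<Rightarrow> real"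
  assumes J: "\<And>v. J v \<noteq> -\<infinity>" "ereal_convex J" and \<phi>: "convex_on X \<phi>"
    and lip: "L-lipschitz_on X \<phi>" and diff: "\<delta>-lipschitz_on X (\<lambda>v. \<psi> v - \<phi> v)"
    and u: "u \<in> edom J \<inter> X"
    and sub: "\<And>x. x \<in> edom J \<inter> X \<Longrightarrow>
      real_of_ereal (J u) + \<psi> u + a \<bullet> (x - u) \<le> real_of_ereal (J x) + \<psi> x"
  obtains \<xi> \<zeta> where "\<xi> \<in> subdifferential X J u" "\<zeta> \<in> subdifferential X (\<lambda>v. ereal (\<phi> v)) u"
    "norm (a - \<xi> - \<zeta>) \<le> \<delta>"
proof -
  let ?A = "edom J \<inter> X"
  define g where "g v = real_of_ereal (J v)" for v
  have fin: "J v = ereal (g v)" if "v \<in> edom J" for v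
    using that J(1)[of v] unfolding g_def by (cases "J v") (auto simp: edom_def)
  have g: "convex_on ?A g"
    unfolding g_def using J convex_on_imp_convex[OF \<phi>] by (rule convex_on_real_of_ereal)
  have g\<phi>: "convex_on ?A (\<lambda>x. g x + \<phi> x)"
    using g convex_on_subset[OF \<phi>] convex_on_imp_convex[OF g] by (intro convex_on_add) auto
  have \<delta>: "\<delta> \<ge> 0" using diff by (rule lipschitz_on_nonneg)
  have "convex_on UNIV (\<lambda>x. norm (x - u))"
    using convex_on_dist[of UNIV u] by (simp add: dist_norm norm_minus_commute)
  then have nconv: "convex_on UNIV (\<lambda>x. \<delta> * norm (x - u))" using \<delta> by (intro convex_on_cmul) auto
  have nlip: "\<delta>-lipschitz_on UNIV (\<lambda>x. \<delta> * norm (x - u))"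
  proof (rule lipschitz_onI)
    fix x y
    have "\<bar>norm (x - u) - norm (y - u)\<bar> \<le> norm (x - y)"
      using norm_triangle_ineq3[of "x - u" "y - u"] by simp
    then show "dist (\<delta> * norm (x - u)) (\<delta> * norm (y - u)) \<le> \<delta> * dist x y"
      using \<delta> by (auto simp: dist_norm abs_mult simp flip: right_diff_distrib intro!: mult_left_mono)
  qed (rule \<delta>)
  have "g u + \<phi> u + \<delta> * norm (u - u) + a \<bullet> (x - u) \<le> g x + \<phi> x + \<delta> * norm (x - u)"
    if x: "x \<in> ?A" for x
  proof -
    have "\<bar>(\<psi> x - \<phi> x) - (\<psi> u - \<phi> u)\<bar> \<le> \<delta> * norm (x - u)"
      using lipschitz_onD[OF diff, of x u] x u by (simp add: dist_norm)
    then show ?thesis using sub[OF x] by (simp add: g_def)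
  qed
  from subgradient_sum_lipschitz[OF g\<phi> nconv subset_UNIV nlip u this]
  obtain a1 e where a1: "a = a1 + e" "\<And>x. x \<in> ?A \<Longrightarrow> g u + \<phi> u + a1 \<bullet> (x - u) \<le> g x + \<phi> x"
    and e: "\<And>x. e \<bullet> (x - u) \<le> \<delta> * norm (x - u)" by auto
  have "norm e \<le> \<delta>"
  proof (cases "e = 0")
    case False
    have "norm e * norm e \<le> \<delta> * norm e"
      using e[of "u + e"] by (simp add: power2_norm_eq_inner flip: power2_eq_square)
    then show ?thesis using False by simp
  qed (simp add: \<delta>)
  from subgradient_sum_lipschitz[OF g \<phi> Int_lower2 lip u a1(2)]
  obtain \<xi> \<zeta> where \<xi>\<zeta>: "a1 = \<xi> + \<zeta>" "\<And>x. x \<in> ?A \<Longrightarrow> g u + \<xi> \<bullet> (x - u) \<le> g x"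
    "\<And>x. x \<in> X \<Longrightarrow> \<phi> u + \<zeta> \<bullet> (x - u) \<le> \<phi> x" by blast
  show thesis
  proof (rule that)
    have "J u + ereal (\<xi> \<bullet> (v - u)) \<le> J v" if "v \<in> X" for v
    proof (cases "v \<in> edom J")
      case True
      then show ?thesis using \<xi>\<zeta>(2)[of v] that fin u by simp
    qed (simp add: edom_def)
    then show "\<xi> \<in> subdifferential X J u" using u fin by (simp add: subdifferential_def)
    show "\<zeta> \<in> subdifferential X (\<lambda>v. ereal (\<phi> v)) u"
      using \<xi>\<zeta>(3) u by (simp add: subdifferential_def)
    show "norm (a - \<xi> - \<zeta>) \<le> \<delta>" using \<open>norm e \<le> \<delta>\<close> a1(1) \<xi>\<zeta>(1) by simp
  qed
qed


section \<open>The dual cone and the constraint map\<close>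

lemma dual_cone_props:
  shows closed_dual_cone: "closed (dual_cone C)" and convex_dual_cone: "convex (dual_cone C)"
    and dual_cone_nonempty: "dual_cone C \<noteq> {}"
proof -
  have eq: "dual_cone C = (\<Inter>x\<in>C. {y. x \<bullet> y \<ge> 0})"
    by (auto simp: dual_cone_def inner_commute)
  show "closed (dual_cone C)" unfolding eq by (intro closed_INT ballI closed_halfspace_ge)
  show "convex (dual_cone C)" unfolding eq by (intro convex_INT convex_halfspace_ge)
  show "dual_cone C \<noteq> {}" by (auto simp: dual_cone_def intro: exI[of _ 0])
qed

lemma closest_point_in_dual_cone: "closest_point (dual_cone C) x \<in> dual_cone C"
  for C :: "'a::euclidean_space set"
  by (rule closest_point_in_set[OF closed_dual_cone dual_cone_nonempty])

lemma dist_closest_point_dual_cone: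
  "dist (closest_point (dual_cone C) x) (closest_point (dual_cone C) y) \<le> dist x y"
  for C :: "'a::euclidean_space set"
  by (rule closest_point_lipschitz[OF convex_dual_cone closed_dual_cone dual_cone_nonempty])

lemma convex_on_inner_cone_convex:
  assumes "cone_convex_on C X F" "convex X" "r \<in> dual_cone C"
  shows "convex_on X (\<lambda>v. r \<bullet> F v)"
proof (rule convex_onI[OF _ assms(2)])
  fix t x y assume t: "0 < (t::real)" "t < 1" and xy: "x \<in> X" "y \<in> X"
  have "1 - t \<in> {0..1}" using t by simp
  then have "F ((1 - t) *\<^sub>R x + (1 - (1 - t)) *\<^sub>R y) 
      - (1 - t) *\<^sub>R F x - (1 - (1 - t)) *\<^sub>R F y \<in> uminus ` C"
    using assms(1) xy unfolding cone_convex_on_def by blast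
  then obtain z where "z \<in> C" "F ((1 - t) *\<^sub>R x + t *\<^sub>R y) - (1 - t) *\<^sub>R F x - t *\<^sub>R F y = - z"
    by auto
  then have "r \<bullet> (F ((1 - t) *\<^sub>R x + t *\<^sub>R y) - (1 - t) *\<^sub>R F x - t *\<^sub>R F y) \<le> 0"
    using assms(3) by (simp add: dual_cone_def)
  then show "r \<bullet> F ((1 - t) *\<^sub>R x + t *\<^sub>R y) \<le> (1 - t) * (r \<bullet> F x) + t * (r \<bullet> F y)"
    by (simp add: inner_diff_right)
qed

text \<open>Replacing \<open>r\<close> by \<open>N *\<^sub>R r\<close> multiplies the variation of the gradient of \<open>r \<bullet> F\<close> by \<open>N\<close>, while
  the bound on it stays the same. So the variation is zero.\<close>
lemma frechet_derivative_constant_on: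
  fixes F :: "'a::euclidean_space \<Rightarrow> 'b::euclidean_space"
  assumes F: "\<And>v. v \<in> X \<Longrightarrow> F differentiable (at v)"
    and lip: "\<And>r. M-lipschitz_on X (gradient (\<lambda>v. r \<bullet> F v))"
    and xy: "x \<in> X" "y \<in> X"
  shows "frechet_derivative F (at x) = frechet_derivative F (at y)"
proof -
  let ?D = "\<lambda>v. frechet_derivative F (at v)"
  have lin: "linear (?D v)" if "v \<in> X" for v using F[OF that] by (rule linear_frechet_derivative)
  have "adjoint (?D x) r = adjoint (?D y) r" for r
  proof (rule ccontr)
    assume "\<not> ?thesis"
    then have d: "norm (adjoint (?D x) r - adjoint (?D y) r) > 0" (is "?d > 0") by simp
    obtain N :: nat where N: "M * dist x y < real N * ?d"
      using reals_Archimedean3[OF d] by blast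
    have "adjoint (?D v) (real N *\<^sub>R r) = real N *\<^sub>R adjoint (?D v) r" if "v \<in> X" for v
      using adjoint_linear[OF lin[OF that]] by (rule linear_scale)
    then have "dist (adjoint (?D x) (real N *\<^sub>R r)) (adjoint (?D y) (real N *\<^sub>R r)) = real N * ?d"
      using xy by (simp add: dist_norm flip: scaleR_diff_right)
    moreover have "dist (adjoint (?D x) (real N *\<^sub>R r)) (adjoint (?D y) (real N *\<^sub>R r)) \<le> M * dist x y"
      using lipschitz_onD[OF lip xy, of "real N *\<^sub>R r"]
      unfolding gradient_inner_eq_adjoint[OF F[OF xy(1)]] gradient_inner_eq_adjoint[OF F[OF xy(2)]] .
    ultimately show False using N by simp
  qed
  then have "h \<bullet> adjoint (?D x) r = h \<bullet> adjoint (?D y) r" for h r by simp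
  then have "?D x h \<bullet> r = ?D y h \<bullet> r" for h r
    using adjoint_works[OF lin[OF xy(1)]] adjoint_works[OF lin[OF xy(2)]] by metis
  then show ?thesis by (metis ext vector_eq_rdot)
qed


section \<open>Zeros of the KKT mappings\<close>

text \<open>This is why the projected multiplier in the second KKT mapping does not change its zeros:
  at a zero, \<open>\<Theta> u\<close> is normal to the dual cone at \<open>p\<close>.\<close>
lemma closest_point_eq_of_normal_cone:
  fixes X :: "'a::euclidean_space set"
  assumes X: "convex X" "closed X" and \<theta>: "\<theta> \<in> normal_cone X p" and \<gamma>: "\<gamma> \<ge> 0"
  shows "closest_point X (p + \<gamma> *\<^sub>R \<theta>) = p"
proof (rule sym, rule closest_point_unique[OF X])
  show "p \<in> X" using \<theta> by (simp add: normal_cone_def)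
  show "\<forall>z\<in>X. dist (p + \<gamma> *\<^sub>R \<theta>) p \<le> dist (p + \<gamma> *\<^sub>R \<theta>) z"
  proof
    fix z assume "z \<in> X"
    then have "\<gamma> * (\<theta> \<bullet> (z - p)) \<le> 0" using \<theta> \<gamma> by (simp add: normal_cone_def mult_nonneg_nonpos)
    moreover have "0 \<le> (norm (z - p))\<^sup>2" by simp
    moreover have "(norm (p + \<gamma> *\<^sub>R \<theta> - z))\<^sup>2
        = (norm (\<gamma> *\<^sub>R \<theta>))\<^sup>2 - 2 * (\<gamma> * (\<theta> \<bullet> (z - p))) + (norm (z - p))\<^sup>2"
      unfolding power2_norm_eq_inner by (simp add: algebra_simps inner_commute)
    ultimately have "(norm (\<gamma> *\<^sub>R \<theta>))\<^sup>2 \<le> (norm (p + \<gamma> *\<^sub>R \<theta> - z))\<^sup>2" by linarith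
    then have "norm (\<gamma> *\<^sub>R \<theta>) \<le> norm (p + \<gamma> *\<^sub>R \<theta> - z)" by (rule power2_le_imp_le) simp
    then show "dist (p + \<gamma> *\<^sub>R \<theta>) p \<le> dist (p + \<gamma> *\<^sub>R \<theta>) z"
      by (simp add: dist_norm)
  qed
qed

text \<open>The lower component says that \<open>p\<close> maximizes the linear function \<open>z \<mapsto> z \<bullet> \<Theta> u\<close> over the dual
  cone. The upper one, added to the subgradient inequalities of the four convex terms, says that
  \<open>u\<close> minimizes the Lagrangian for this \<open>p\<close>.\<close>
lemma kkt_zero_imp_saddle_point:
  fixes U :: "'a::euclidean_space set" and C :: "'b::euclidean_space set"
  assumes U: "convex U" and G: "convex_on UNIV G" "\<And>v. G differentiable (at v)"
    and \<Omega>: "cone_convex_on C U \<Omega>" "\<And>v. \<Omega> differentiable (at v)"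
    and zero: "0 \<in> kkt_map G J \<Omega> \<Phi> U C w"
  shows "w \<in> saddle_points G J (\<lambda>v. \<Omega> v + \<Phi> v) U C"
proof -
  obtain u p where w: "w = (u, p)" by (cases w)
  obtain \<xi> \<zeta> \<nu> where \<xi>: "\<xi> \<in> subdifferential U J u"
    and \<zeta>: "\<zeta> \<in> subdifferential U (\<lambda>v. ereal (p \<bullet> \<Phi> v)) u" and \<nu>: "\<nu> \<in> normal_cone U u"
    and sum: "gradient G u + \<xi> + (adjoint (frechet_derivative \<Omega> (at u)) p + \<zeta>) + \<nu> = 0"
    using zero by (auto simp: w kkt_map_def kkt_stationarity_def zero_prod_def)
  have "\<exists>\<mu>\<in>normal_cone (dual_cone C) p. - (\<Omega> u + \<Phi> u) + \<mu> = 0"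
    using zero unfolding w kkt_map_def by (auto simp: zero_prod_def simp del: minus_add_distrib)
  then have \<theta>: "\<Omega> u + \<Phi> u \<in> normal_cone (dual_cone C) p"
    by (metis add_eq_0_iff minus_minus)
  then have p: "p \<in> dual_cone C" by (simp add: normal_cone_def)
  have u: "u \<in> U" using \<nu> by (simp add: normal_cone_def)
  obtain j where j: "J u = ereal j" using \<xi> by (cases "J u") (auto simp: subdifferential_def)
  have "lagrangian G J (\<lambda>v. \<Omega> v + \<Phi> v) u z \<le> lagrangian G J (\<lambda>v. \<Omega> v + \<Phi> v) u p"
    if "z \<in> dual_cone C" for z
    using \<theta> that by (auto simp: lagrangian_def j normal_cone_def inner_diff_right inner_commute)
  moreover have "lagrangian G J (\<lambda>v. \<Omega> v + \<Phi> v) u p \<le> lagrangian G J (\<lambda>v. \<Omega> v + \<Phi> v) v p"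
    if v: "v \<in> U" for v
  proof -
    have 1: "G u + gradient G u \<bullet> (v - u) \<le> G v"
      using convex_on_tangent_below[OF G(1) UNIV_I UNIV_I has_derivative_gradient[OF G(2)]] .
    have 2: "p \<bullet> \<Omega> u + adjoint (frechet_derivative \<Omega> (at u)) p \<bullet> (v - u) \<le> p \<bullet> \<Omega> v"
      using convex_on_tangent_below[OF convex_on_inner_cone_convex[OF \<Omega>(1) U p] u v
          has_derivative_inner_adjoint[OF \<Omega>(2)]] .
    have 3: "p \<bullet> \<Phi> u + \<zeta> \<bullet> (v - u) \<le> p \<bullet> \<Phi> v" using \<zeta> v by (auto simp: subdifferential_def)
    have 4: "\<nu> \<bullet> (v - u) \<le> 0" using \<nu> v by (simp add: normal_cone_def)
    have 5: "J u + ereal (\<xi> \<bullet> (v - u)) \<le> J v" using \<xi> v by (auto simp: subdifferential_def)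
    have "(gradient G u + \<xi> + (adjoint (frechet_derivative \<Omega> (at u)) p + \<zeta>) + \<nu>) \<bullet> (v - u) = 0"
      unfolding sum by simp
    then show ?thesis using 1 2 3 4 5
      by (cases "J v") (auto simp: lagrangian_def j inner_add_left inner_add_right)
  qed
  ultimately show ?thesis using u p by (simp add: saddle_points_def w)
qed

lemma kkt_map_aug_zero_imp_kkt_map_zero:
  fixes U :: "'a::euclidean_space set" and C :: "'b::euclidean_space set"
  assumes "\<gamma> \<ge> 0" and zero: "0 \<in> kkt_map_aug \<gamma> G J \<Omega> \<Phi> U C w"
  shows "0 \<in> kkt_map G J \<Omega> \<Phi> U C w"
proof -
  obtain u p where w: "w = (u, p)" by (cases w)
  have "\<exists>\<mu>\<in>normal_cone (dual_cone C) p. - (\<Omega> u + \<Phi> u) + \<mu> = 0"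
    using zero unfolding w kkt_map_aug_def by (auto simp: zero_prod_def simp del: minus_add_distrib)
  then have "\<Omega> u + \<Phi> u \<in> normal_cone (dual_cone C) p"
    by (metis add_eq_0_iff minus_minus)
  then have "closest_point (dual_cone C) (p + \<gamma> *\<^sub>R (\<Omega> u + \<Phi> u)) = p"
    using closest_point_eq_of_normal_cone[OF convex_dual_cone closed_dual_cone] assms(1) by blast
  then show ?thesis using zero by (simp add: w kkt_map_def kkt_map_aug_def)
qed


section \<open>Residual of a VAPP step\<close>

text \<open>A projection step moves from \<open>p + \<gamma> *\<^sub>R \<theta>\<close> along a normal vector; divided by \<open>\<gamma>\<close>, this
  normal vector is \<open>\<theta>\<close> plus the scaled change of \<open>p\<close>. With \<open>\<theta> = \<Theta> u\<close>, the change of the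
  multiplier is therefore the residual of the lower KKT component.\<close>
lemma closest_point_residual_in_normal_cone:
  fixes X :: "'a::euclidean_space set"
  assumes X: "convex X" "closed X" "X \<noteq> {}" and \<gamma>: "\<gamma> > 0"
  shows "\<theta> + (p - closest_point X (p + \<gamma> *\<^sub>R \<theta>)) /\<^sub>R \<gamma>
    \<in> normal_cone X (closest_point X (p + \<gamma> *\<^sub>R \<theta>))" (is "?\<mu> \<in> normal_cone X ?x")
proof -
  have "?\<mu> \<bullet> (z - ?x) \<le> 0" if "z \<in> X" for z
  proof -
    have "\<gamma> *\<^sub>R ?\<mu> = p + \<gamma> *\<^sub>R \<theta> - ?x" using \<gamma> by (simp add: algebra_simps)
    then have "\<gamma> * (?\<mu> \<bullet> (z - ?x)) = (p + \<gamma> *\<^sub>R \<theta> - ?x) \<bullet> (z - ?x)"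
      by (metis inner_scaleR_left)
    also have "\<dots> \<le> 0" by (rule closest_point_dot[OF X(1,2) that])
    finally show ?thesis using \<gamma> by (simp add: mult_le_0_iff)
  qed
  then show ?thesis using closest_point_in_set[OF X(2,3)] by (simp add: normal_cone_def)
qed

text \<open>Optimality in the subproblem: \<open>a\<close> is minus the gradient at \<open>y\<close> of its smooth part, which
  consists of the linearizations at \<open>x\<close> and of the Bregman distance.\<close>
lemma vapp_subproblem_subgradient:
  fixes U :: "'a::euclidean_space set" and C :: "'b::euclidean_space set"
  assumes U: "convex U" and J: "\<And>v. J v \<noteq> -\<infinity>" "ereal_convex J" "edom J \<inter> U \<noteq> {}"
    and \<Omega>: "\<Omega> differentiable (at x)" and \<Phi>: "cone_convex_on C U \<Phi>" and q: "q \<in> dual_cone C"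
    and K: "K differentiable (at y)"
    and min: "is_arg_min (vapp_objective G J \<Omega> \<Phi> K \<epsilon> x q) (\<lambda>v. v \<in> U) y"
    and a: "a = - (gradient G x + adjoint (frechet_derivative \<Omega> (at x)) q
      + (1 / \<epsilon>) *\<^sub>R (gradient K y - gradient K x))"
  shows "y \<in> edom J \<inter> U"
    and "v \<in> edom J \<inter> U \<Longrightarrow>
      real_of_ereal (J y) + q \<bullet> \<Phi> y + a \<bullet> (v - y) \<le> real_of_ereal (J v) + q \<bullet> \<Phi> v"
proof -
  define s where "s v = gradient G x \<bullet> v + adjoint (frechet_derivative \<Omega> (at x)) q \<bullet> v
    + 1 / \<epsilon> * bregman K v x" for v
  define \<phi> where "\<phi> v = real_of_ereal (J v) + q \<bullet> \<Phi> v" for v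
  let ?obj = "vapp_objective G J \<Omega> \<Phi> K \<epsilon> x q"
  have le: "?obj y \<le> ?obj v" if "v \<in> U" for v
    using min that by (auto simp: is_arg_min_def not_less)
  have obj: "?obj v = ereal (s v + \<phi> v)" if "v \<in> edom J" for v
    using that J(1)[of v]
    by (cases "J v") (auto simp: edom_def vapp_objective_def s_def \<phi>_def inner_add_right
        inner_adjoint_frechet_derivative[OF \<Omega>])
  obtain v0 where v0: "v0 \<in> edom J" "v0 \<in> U" using J(3) by blast
  have "?obj y < \<infinity>" using le[OF v0(2)] obj[OF v0(1)] by auto
  then have "J y < \<infinity>" by (cases "J y") (auto simp: vapp_objective_def)
  then show y: "y \<in> edom J \<inter> U" using min by (simp add: edom_def is_arg_min_def)
  assume v: "v \<in> edom J \<inter> U"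
  have g: "convex_on (edom J \<inter> U) (\<lambda>v. real_of_ereal (J v))"
    by (rule convex_on_real_of_ereal[OF J(1,2) U])
  have bregman: "((\<lambda>v. bregman K v x) has_derivative
      (\<lambda>h. gradient K y \<bullet> h - gradient K x \<bullet> h)) (at y)"
    unfolding bregman_def using has_derivative_gradient[OF K]
    by (auto intro!: derivative_eq_intros)
  have "convex_on (edom J \<inter> U) \<phi>"
    unfolding \<phi>_def using g convex_on_subset[OF convex_on_inner_cone_convex[OF \<Phi> U q]]
      convex_on_imp_convex[OF g] by (intro convex_on_add) auto
  moreover have "(s has_derivative (\<lambda>h. - a \<bullet> h)) (at y)"
    unfolding s_def a
    by (rule has_derivative_eq_rhs[OF has_derivative_add[OF has_derivative_add
          has_derivative_mult_right[OF bregman]]])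
       (auto intro!: derivative_eq_intros
         simp: fun_eq_iff inner_add_left inner_diff_left right_diff_distrib diff_divide_distrib)
  moreover have "s y + \<phi> y \<le> s z + \<phi> z" if "z \<in> edom J \<inter> U" for z
    using le[of z] obj[of y] obj[of z] y that by simp
  ultimately have "\<phi> y \<le> \<phi> v + - a \<bullet> (v - y)"
    using minimizer_smooth_plus_convex[of "edom J \<inter> U" \<phi> y v s] y v by blast
  then show "real_of_ereal (J y) + q \<bullet> \<Phi> y + a \<bullet> (v - y) \<le> real_of_ereal (J v) + q \<bullet> \<Phi> v"
    by (simp add: \<phi>_def)
qed

text \<open>The upper KKT component at the new point \<open>y\<close> with multiplier \<open>r\<close>. Comparing it with the
  optimality condition of the subproblem, which uses the gradients at \<open>x\<close> and the multiplier
  \<open>q\<close>, leaves the change of the gradient of \<open>G\<close>, the scaled change of the gradient of \<open>K\<close>, and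
  two terms proportional to \<open>q - r\<close>: one from the derivative of \<open>\<Omega>\<close>, one from the error of
  \<open>perturbed_subgradient_split\<close>.\<close>
lemma vapp_stationarity_residual:
  fixes U :: "'a::euclidean_space set" and C :: "'b::euclidean_space set"
  assumes U: "convex U" and J: "\<And>v. J v \<noteq> -\<infinity>" "ereal_convex J" "edom J \<inter> U \<noteq> {}"
    and G: "B\<^sub>G-lipschitz_on U (gradient G)"
    and \<Omega>: "\<Omega> differentiable (at x)" "frechet_derivative \<Omega> (at y) = frechet_derivative \<Omega> (at x)"
    and \<Phi>: "cone_convex_on C U \<Phi>" "L-lipschitz_on U \<Phi>"
    and K: "K differentiable (at y)" "B-lipschitz_on U (gradient K)"
    and x: "x \<in> U" and q: "q \<in> dual_cone C" and r: "r \<in> dual_cone C"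
    and \<epsilon>: "0 < \<epsilon>\<^sub>0" "\<epsilon>\<^sub>0 \<le> \<epsilon>"
    and min: "is_arg_min (vapp_objective G J \<Omega> \<Phi> K \<epsilon> x q) (\<lambda>v. v \<in> U) y"
  obtains h where "h \<in> kkt_stationarity G J \<Omega> \<Phi> U y r"
    "norm h \<le> (B\<^sub>G + B / \<epsilon>\<^sub>0) * norm (x - y)
      + (onorm (adjoint (frechet_derivative \<Omega> (at x))) + L) * norm (q - r)"
proof -
  let ?T = "adjoint (frechet_derivative \<Omega> (at x))"
  define a where "a = - (gradient G x + ?T q + (1 / \<epsilon>) *\<^sub>R (gradient K y - gradient K x))"
  note sub = vapp_subproblem_subgradient[OF U J \<Omega>(1) \<Phi>(1) q K(1) min a_def]
  have y: "y \<in> U" using sub(1) by simp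
  have ip: "(L * norm m)-lipschitz_on U (\<lambda>v. m \<bullet> \<Phi> v)" for m
  proof (rule lipschitz_onI)
    fix v w assume "v \<in> U" "w \<in> U"
    then have "norm (\<Phi> v - \<Phi> w) \<le> L * norm (v - w)"
      using lipschitz_onD[OF \<Phi>(2)] by (simp add: dist_norm)
    then have "norm m * norm (\<Phi> v - \<Phi> w) \<le> norm m * (L * norm (v - w))"
      by (rule mult_left_mono) simp
    then show "dist (m \<bullet> \<Phi> v) (m \<bullet> \<Phi> w) \<le> L * norm m * dist v w"
      using Cauchy_Schwarz_ineq2[of m "\<Phi> v - \<Phi> w"]
      by (simp add: dist_norm inner_diff_right algebra_simps)
  qed (use lipschitz_on_nonneg[OF \<Phi>(2)] in simp)
  have diff: "(L * norm (q - r))-lipschitz_on U (\<lambda>v. q \<bullet> \<Phi> v - r \<bullet> \<Phi> v)"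
    using ip[of "q - r"] by (simp add: inner_diff_left)
  from perturbed_subgradient_split[OF J(1,2) convex_on_inner_cone_convex[OF \<Phi>(1) U r]
      ip diff sub]
  obtain \<xi> \<zeta> where \<xi>: "\<xi> \<in> subdifferential U J y"
    and \<zeta>: "\<zeta> \<in> subdifferential U (\<lambda>v. ereal (r \<bullet> \<Phi> v)) y"
    and e: "norm (a - \<xi> - \<zeta>) \<le> L * norm (q - r)" by blast
  define h where "h = gradient G y + \<xi> + (?T r + \<zeta>) + 0"
  have "0 \<in> normal_cone U y" using y by (simp add: normal_cone_def)
  then have "h \<in> kkt_stationarity G J \<Omega> \<Phi> U y r"
    unfolding kkt_stationarity_def h_def \<Omega>(2) using \<xi> \<zeta> by blast
  moreover have "norm h \<le> (B\<^sub>G + B / \<epsilon>\<^sub>0) * norm (x - y) + (onorm ?T + L) * norm (q - r)"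
  proof -
    have linT: "linear ?T" by (rule adjoint_linear[OF linear_frechet_derivative[OF \<Omega>(1)]])
    have 1: "norm (gradient G y - gradient G x) \<le> B\<^sub>G * norm (x - y)"
      using lipschitz_onD[OF G y x] by (simp add: dist_norm norm_minus_commute)
    have 2: "norm (?T (r - q)) \<le> onorm ?T * norm (q - r)"
      using onorm[of ?T "r - q"] linT by (simp add: linear_conv_bounded_linear norm_minus_commute)
    have 3: "norm ((1 / \<epsilon>) *\<^sub>R (gradient K y - gradient K x)) \<le> B / \<epsilon>\<^sub>0 * norm (x - y)"
    proof -
      have "norm (gradient K y - gradient K x) \<le> B * norm (x - y)"
        using lipschitz_onD[OF K(2) y x] by (simp add: dist_norm norm_minus_commute)
      then have "1 / \<epsilon> * norm (gradient K y - gradient K x) \<le> 1 / \<epsilon>\<^sub>0 * (B * norm (x - y))"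
        using \<epsilon> by (intro mult_mono) (auto intro: divide_left_mono)
      then show ?thesis using \<epsilon> by simp
    qed
    have "h = (gradient G y - gradient G x) + ?T (r - q)
        - (1 / \<epsilon>) *\<^sub>R (gradient K y - gradient K x) - (a - \<xi> - \<zeta>)"
      unfolding h_def a_def linear_diff[OF linT] by (simp add: algebra_simps)
    moreover have "norm (h1 + h2 - h3 - h4) \<le> norm h1 + norm h2 + norm h3 + norm h4"
      for h1 h2 h3 h4 :: 'a
      using norm_triangle_ineq4[of "h1 + h2 - h3" h4] norm_triangle_ineq4[of "h1 + h2" h3]
        norm_triangle_ineq[of h1 h2] by linarith
    ultimately have "norm h \<le> norm (gradient G y - gradient G x) + norm (?T (r - q))
        + norm ((1 / \<epsilon>) *\<^sub>R (gradient K y - gradient K x)) + norm (a - \<xi> - \<zeta>)"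
      by metis
    then show ?thesis using 1 2 3 e by (simp add: algebra_simps)
  qed
  ultimately show thesis by (rule that)
qed

lemma metric_subregular_imp_error_bound:
  fixes w :: "nat \<Rightarrow> 'a::real_normed_vector" and F :: "'a \<Rightarrow> 'b::real_normed_vector set"
  assumes subreg: "metric_subregular_at_zero F ws"
    and zeros: "\<And>v. 0 \<in> F v \<Longrightarrow> v \<in> S"
    and res: "\<And>k. \<exists>h\<in>F (w (Suc k)). norm h \<le> c * norm (w k - w (Suc k))"
  shows "\<exists>c\<^sub>1>0. \<exists>\<eta>>0. \<forall>k. norm (w (Suc k) - ws) \<le> \<eta> \<longrightarrow>
    dist_to_set (w (Suc k)) S \<le> ereal (c\<^sub>1 * norm (w k - w (Suc k)))"
proof -
  obtain \<eta> c2 where \<eta>: "\<eta> > 0" and c2: "c2 > 0"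
    and sr: "\<And>v. norm (v - ws) \<le> \<eta> \<Longrightarrow>
      dist_to_set v {v. 0 \<in> F v} \<le> ereal c2 * dist_to_set 0 (F v)"
    using subreg unfolding metric_subregular_at_zero_def by blast
  have "dist_to_set (w (Suc k)) S \<le> ereal (c2 * max c 1 * norm (w k - w (Suc k)))"
    \<comment> \<open>The maximum makes the final constant positive for every \<open>c\<close>.\<close>
    if k: "norm (w (Suc k) - ws) \<le> \<eta>" for k
  proof -
    obtain h where h: "h \<in> F (w (Suc k))" "norm h \<le> c * norm (w k - w (Suc k))"
      using res by blast
    have "norm h \<le> max c 1 * norm (w k - w (Suc k))"
      using h(2) by (rule order_trans) (simp add: mult_right_mono)
    then have "dist_to_set 0 (F (w (Suc k))) \<le> ereal (max c 1 * norm (w k - w (Suc k)))"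
      unfolding dist_to_set_def using h(1) by (intro INF_lower2[of h]) auto
    then have "ereal c2 * dist_to_set 0 (F (w (Suc k)))
        \<le> ereal c2 * ereal (max c 1 * norm (w k - w (Suc k)))"
      using c2 by (intro ereal_mult_left_mono) auto
    moreover have "dist_to_set (w (Suc k)) S \<le> dist_to_set (w (Suc k)) {v. 0 \<in> F v}"
      unfolding dist_to_set_def using zeros by (intro INF_superset_mono) auto
    ultimately show ?thesis using sr[OF k] by (simp add: mult.assoc)
  qed
  then show ?thesis using \<eta> c2 by (intro exI[of _ "c2 * max c 1"]) (auto intro!: exI[of _ \<eta>])
qed


theorem proposition2:
  fixes U :: "(real^'n) set" and C :: "(real^'m) set"
    and G :: "real^'n \<Rightarrow> real" and J :: "real^'n \<Rightarrow> ereal"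
    and \<Omega> \<Phi> \<Theta> :: "real^'n \<Rightarrow> real^'m" and K :: "real^'n \<Rightarrow> real"
    and B\<^sub>G B\<^sub>\<Omega> \<tau> \<beta> B \<gamma> \<epsilon>_lo \<epsilon>_hi :: real and \<epsilon> :: "nat \<Rightarrow> real"
    and u :: "nat \<Rightarrow> real^'n" and p q :: "nat \<Rightarrow> real^'m"
    and ws :: "(real^'n) \<times> (real^'m)"
  assumes U: "U \<noteq> {}" "closed U" "convex U"
    and C: "C \<noteq> {}" "closed C" "convex C" "cone C"
    and Theta: "\<Theta> = (\<lambda>v. \<Omega> v + \<Phi> v)"
    and H1: "\<And>v. J v \<noteq> -\<infinity>" "ereal_convex J" "lower_semicont J" "edom J \<inter> U \<noteq> {}"
    and H2: "convex_on UNIV G" "\<And>v. G differentiable (at v)" "B\<^sub>G-lipschitz_on UNIV (gradient G)"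
    and H3: "cone_convex_on C U \<Omega>" "cone_convex_on C U \<Phi>"
    and H4: "\<And>v. \<Omega> differentiable (at v)"
      "\<And>r. B\<^sub>\<Omega>-lipschitz_on U (gradient (\<lambda>v. r \<bullet> \<Omega> v))"
    and H5: "\<exists>V. open V \<and> U \<subseteq> V \<and> \<tau>-lipschitz_on V \<Theta>"
    and H6: "interior C \<noteq> {} \<Longrightarrow> \<Theta> ` U \<inter> uminus ` interior C \<noteq> {}"
      "C = {0} \<Longrightarrow> 0 \<in> interior (\<Theta> ` U)"
    and H7: "saddle_points G J \<Theta> U C \<noteq> {}"
    and K: "\<beta> > 0" "strongly_convex_on U \<beta> K" "\<And>v. v \<in> U \<Longrightarrow> K differentiable (at v)"
      "B-lipschitz_on U (gradient K)"
    and \<gamma>: "\<gamma> > 0"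
    and init: "u 0 \<in> U" "p 0 \<in> dual_cone C"
    and vapp_q: "\<And>k. q k = closest_point (dual_cone C) (p k + \<gamma> *\<^sub>R \<Theta> (u k))"
    and vapp_u: "\<And>k. is_arg_min (vapp_objective G J \<Omega> \<Phi> K (\<epsilon> k) (u k) (q k)) (\<lambda>v. v \<in> U) (u (Suc k))"
    and vapp_p: "\<And>k. p (Suc k) = closest_point (dual_cone C) (p k + \<gamma> *\<^sub>R \<Theta> (u (Suc k)))"
    and eps: "0 < \<epsilon>_lo" "\<And>k. \<epsilon>_lo \<le> \<epsilon> (Suc k)" "\<And>k. \<epsilon> (Suc k) \<le> \<epsilon> k" "\<And>k. \<epsilon> k \<le> \<epsilon>_hi"
      "\<epsilon>_hi * (B\<^sub>G + B\<^sub>\<Omega> + \<gamma> * \<tau>\<^sup>2) < \<beta>"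
    and conv: "(\<lambda>k. (u k, p k)) \<longlonglongrightarrow> ws" "ws \<in> saddle_points G J \<Theta> U C"
    and subreg: "metric_subregular_at_zero (kkt_map G J \<Omega> \<Phi> U C) ws \<or>
      metric_subregular_at_zero (kkt_map_aug \<gamma> G J \<Omega> \<Phi> U C) ws"
  shows "\<exists>c\<^sub>1>0. \<exists>\<eta>>0. \<forall>k. norm ((u (Suc k), p (Suc k)) - ws) \<le> \<eta> \<longrightarrow>
    dist_to_set (u (Suc k), p (Suc k)) (saddle_points G J \<Theta> U C)
      \<le> ereal (c\<^sub>1 * norm ((u k, p k) - (u (Suc k), p (Suc k))))"
proof -
  have onto: "u k \<in> U" for k
    using init(1) vapp_u by (cases k) (auto simp: is_arg_min_def)
  have qk: "q k \<in> dual_cone C" for k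
    unfolding vapp_q by (rule closest_point_in_dual_cone)
  have \<epsilon>k: "\<epsilon>_lo \<le> \<epsilon> k" for k using eps(2,3) order_trans by blast
  have D: "frechet_derivative \<Omega> (at x) = frechet_derivative \<Omega> (at y)" if "x \<in> U" "y \<in> U" for x y
    using frechet_derivative_constant_on[OF H4 that] .
  define A where "A = frechet_derivative \<Omega> (at (u 0))"
  have DA: "frechet_derivative \<Omega> (at x) = A" if "x \<in> U" for x
    unfolding A_def using that onto by (rule D)
  have linA: "linear A" unfolding A_def by (rule linear_frechet_derivative[OF H4(1)])
  have nA: "onorm A \<ge> 0" "onorm (adjoint A) \<ge> 0"
    using linA adjoint_linear[OF linA]
    by (auto intro!: onorm_pos_le simp: linear_conv_bounded_linear)
  obtain V where "U \<subseteq> V" "\<tau>-lipschitz_on V \<Theta>" using H5 by blast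
  then have lipT: "\<tau>-lipschitz_on U \<Theta>" by (meson lipschitz_on_subset)
  have "(onorm A)-lipschitz_on U \<Omega>"
  proof (rule lipschitz_onI)
    fix x y assume xy: "x \<in> U" "y \<in> U"
    have "(\<Omega> has_derivative A) (at z within U)" if "z \<in> U" for z
      using H4(1)[of z] DA[OF that] unfolding frechet_derivative_works
      by (metis has_derivative_at_withinI)
    from differentiable_bound[OF U(3) this order_refl xy]
    show "dist (\<Omega> x) (\<Omega> y) \<le> onorm A * dist x y" by (simp add: dist_norm)
  qed (rule nA)
  then have "(\<tau> + onorm A)-lipschitz_on U (\<lambda>v. \<Theta> v - \<Omega> v)"
    by (rule lipschitz_on_diff[OF lipT])
  then have lipP: "(\<tau> + onorm A)-lipschitz_on U \<Phi>" by (simp add: Theta)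
  define L where "L = \<tau> + onorm A"
  have nn: "0 \<le> \<tau>" "0 \<le> L" "0 \<le> B\<^sub>G" "0 \<le> B"
    using lipschitz_on_nonneg[OF lipT] lipschitz_on_nonneg[OF lipP] lipschitz_on_nonneg[OF H2(3)]
      lipschitz_on_nonneg[OF K(4)] by (auto simp: L_def)
  define w where "w k = (u k, p k)" for k
  define M where "M = onorm (adjoint A) + L"
  define c where "c = (B\<^sub>G + B / \<epsilon>_lo) + M * (1 + \<gamma> * \<tau>) + 1 / \<gamma>"
  have M: "M \<ge> 0" using nA nn by (simp add: M_def)
  have comp: "norm (u k - u (Suc k)) \<le> norm (w k - w (Suc k))"
    "norm (p k - p (Suc k)) \<le> norm (w k - w (Suc k))" for k
    using norm_fst_le[of "u k - u (Suc k)" "p k - p (Suc k)"]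
      norm_snd_le[of "p k - p (Suc k)" "u k - u (Suc k)"] by (auto simp: w_def)
  \<comment> \<open>The multiplier \<open>r\<close> is the projection started from \<open>z\<close>. The choice \<open>z = p k\<close> gives
    \<open>r = p (Suc k)\<close> and the first KKT mapping, \<open>z = p (Suc k)\<close> gives the second one.\<close>
  have residual: "\<exists>h. h \<in> kkt_stationarity G J \<Omega> \<Phi> U (u (Suc k)) r \<times>
       {- (\<Omega> (u (Suc k)) + \<Phi> (u (Suc k))) + \<mu> |\<mu>. \<mu> \<in> normal_cone (dual_cone C) (p (Suc k))}
      \<and> norm h \<le> c * norm (w k - w (Suc k))"
    if r: "r = closest_point (dual_cone C) (z + \<gamma> *\<^sub>R \<Theta> (u (Suc k)))"
      and z: "norm (p k - z) \<le> norm (p k - p (Suc k))" for k r z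
  proof -
    let ?N = "norm (w k - w (Suc k))"
    have rC: "r \<in> dual_cone C" unfolding r by (rule closest_point_in_dual_cone)
    obtain h1 where h1: "h1 \<in> kkt_stationarity G J \<Omega> \<Phi> U (u (Suc k)) r"
      "norm h1 \<le> (B\<^sub>G + B / \<epsilon>_lo) * norm (u k - u (Suc k)) + M * norm (q k - r)"
      using vapp_stationarity_residual[OF U(3) H1(1,2,4) lipschitz_on_subset[OF H2(3) subset_UNIV]
          H4(1) D[OF onto onto] H3(2) lipP K(3)[OF onto] K(4) onto qk rC eps(1) \<epsilon>k vapp_u]
      unfolding DA[OF onto] M_def L_def by blast
    have "norm (q k - r) \<le> norm ((p k - z) + \<gamma> *\<^sub>R (\<Theta> (u k) - \<Theta> (u (Suc k))))"
      using dist_closest_point_dual_cone[of C "p k + \<gamma> *\<^sub>R \<Theta> (u k)" "z + \<gamma> *\<^sub>R \<Theta> (u (Suc k))"]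
      by (simp add: vapp_q r dist_norm algebra_simps)
    also have "\<dots> \<le> norm (p k - z) + \<gamma> * norm (\<Theta> (u k) - \<Theta> (u (Suc k)))"
      using norm_triangle_ineq[of "p k - z"] \<gamma> by (metis abs_of_pos norm_scaleR)
    also have "norm (\<Theta> (u k) - \<Theta> (u (Suc k))) \<le> \<tau> * norm (u k - u (Suc k))"
      using lipschitz_onD[OF lipT onto onto] by (simp add: dist_norm)
    also have "norm (p k - z) + \<gamma> * (\<tau> * norm (u k - u (Suc k))) \<le> ?N + \<gamma> * (\<tau> * ?N)"
      using z comp[of k] \<gamma> nn by (intro add_mono mult_left_mono) auto
    finally have qr: "norm (q k - r) \<le> (1 + \<gamma> * \<tau>) * ?N" using \<gamma> by (simp add: algebra_simps)
    have "norm h1 \<le> (B\<^sub>G + B / \<epsilon>_lo) * ?N + M * ((1 + \<gamma> * \<tau>) * ?N)"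
      using h1(2) by (rule order_trans)
        (use comp[of k] qr M nn eps(1) in \<open>intro add_mono mult_left_mono; simp\<close>)
    moreover define h2 where "h2 = (p k - p (Suc k)) /\<^sub>R \<gamma>"
    moreover have "norm h2 \<le> 1 / \<gamma> * ?N"
      using comp(2)[of k] \<gamma> by (simp add: h2_def divide_inverse mult_left_mono mult.commute)
    ultimately have "norm (h1, h2) \<le> c * ?N"
      using norm_Pair_le[of h1 h2] by (simp add: c_def algebra_simps)
    moreover have "\<Theta> (u (Suc k)) + h2 \<in> normal_cone (dual_cone C) (p (Suc k))"
      unfolding h2_def vapp_p
      by (rule closest_point_residual_in_normal_cone[OF convex_dual_cone closed_dual_cone
          dual_cone_nonempty \<gamma>])
    then have "h2 \<in> {- (\<Omega> (u (Suc k)) + \<Phi> (u (Suc k))) + \<mu> |\<mu>.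
        \<mu> \<in> normal_cone (dual_cone C) (p (Suc k))}"
      by (force simp: Theta)
    ultimately show ?thesis using h1(1) by blast
  qed
  have saddle: "v \<in> saddle_points G J \<Theta> U C" if "0 \<in> kkt_map G J \<Omega> \<Phi> U C v" for v
    unfolding Theta by (rule kkt_zero_imp_saddle_point[OF U(3) H2(1,2) H3(1) H4(1) that])
  show ?thesis
    using subreg
  proof
    assume sr: "metric_subregular_at_zero (kkt_map G J \<Omega> \<Phi> U C) ws"
    have "\<exists>h\<in>kkt_map G J \<Omega> \<Phi> U C (w (Suc k)). norm h \<le> c * norm (w k - w (Suc k))" for k
      using residual[OF vapp_p, of k] by (auto simp: kkt_map_def w_def)
    from metric_subregular_imp_error_bound[where w = w, OF sr saddle this]
    show ?thesis by (simp add: w_def)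
  next
    assume sr: "metric_subregular_at_zero (kkt_map_aug \<gamma> G J \<Omega> \<Phi> U C) ws"
    have saddle_aug: "v \<in> saddle_points G J \<Theta> U C" if "0 \<in> kkt_map_aug \<gamma> G J \<Omega> \<Phi> U C v" for v
      using saddle kkt_map_aug_zero_imp_kkt_map_zero[OF _ that] \<gamma> by simp
    have "\<exists>h\<in>kkt_map_aug \<gamma> G J \<Omega> \<Phi> U C (w (Suc k)). norm h \<le> c * norm (w k - w (Suc k))" for k
      using residual[OF refl order_refl, of k] by (auto simp: kkt_map_aug_def w_def Theta)
    from metric_subregular_imp_error_bound[where w = w, OF sr saddle_aug this]
    show ?thesis by (simp add: w_def)
  qed
qed

end
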